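(* Let $G$ and $H$ be graphs. There exists a real number $c$ such that $t(G,T)\geq t(H,T)^c$ for all graphs $T$ (so that the homomorphism density domination exponent $C(G,H)$ exists) if and only if $t(G,H)>0$. Moreover, in that case $$C(G,H)\leq \begin{cases}\left(\frac{v(G)}{v(H)}\right)^{v(H)} & \text{if } v(H)\leq \frac{v(G)}{e},\\ e^{v(G)/e} & \text{if } v(H)\geq \frac{v(G)}{e},\end{cases}$$ where $e=2.718\ldots$ is Euler's number.
   Context: All graphs are finite and simple; $v(\cdot)$ denotes number of vertices. $\operatorname{hom}(H,T)$ is the number of maps $V(H)\to V(T)$ sending every edge of $H$ to an edge of $T$, and $t(H,T)=\operatorname{hom}(H,T)/v(T)^{v(H)}$. The homomorphism density domination exponent is $C(G,H)=\min\{c\in\mathbb{R}: t(G,T)\geq t(H,T)^c \text{ for all graphs } T\}$ (when this set is nonempty).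
   Formalization: If H has no edge and t(G,H)>0, all densities are 1, every real c is admissible and the minimum C(G,H) does not exist; so existence of C(G,H) is claimed only when H has an edge. H and T are taken nonempty, and T ranges over finite graphs up to isomorphism. *)

theory Defs
  imports Complex_Main "HOL-Library.FuncSet" "Graph_Theory.Pair_Digraph"
begin

text \<open>
  Finite simple graphs are the library's \<^const>\<open>pair_graph\<close>s: finite vertex set
  \<^const>\<open>pverts\<close>, and an irreflexive symmetric adjacency relation \<^const>\<open>parcs\<close>
  on it (an edge \<open>{u, v}\<close> is represented by the two pairs \<open>(u, v)\<close> and \<open>(v, u)\<close>).
\<close>

definition graph_homs :: "'a pair_pre_digraph \<Rightarrow> 'b pair_pre_digraph \<Rightarrow> ('a \<Rightarrow> 'b) set" where
  "graph_homs H T =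
     {f \<in> pverts H \<rightarrow>\<^sub>E pverts T. \<forall>(u, v) \<in> parcs H. (f u, f v) \<in> parcs T}"

definition hom_count :: "'a pair_pre_digraph \<Rightarrow> 'b pair_pre_digraph \<Rightarrow> nat" where
  "hom_count H T = card (graph_homs H T)"

definition hom_density :: "'a pair_pre_digraph \<Rightarrow> 'b pair_pre_digraph \<Rightarrow> real" where
  "hom_density H T = real (hom_count H T) / real (card (pverts T)) ^ card (pverts H)"

text \<open>
  The target \<open>T\<close> ranges over graphs on finite nonempty sets of natural numbers; every
  nonempty finite graph is isomorphic to such a graph, and densities are isomorphism
  invariant. The null graph is excluded because the density in it is not defined.

  In HOL, \<open>0 powr c = 0\<close> for every \<open>c\<close>, also for \<open>c \<le> 0\<close>. This does not change the set
  of admissible exponents: if \<open>H\<close> has no edge then the density of \<open>H\<close> is always 1, and if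
  \<open>H\<close> has an edge then large complete graphs \<open>T\<close>, in which the density of \<open>H\<close> lies strictly
  between 0 and 1, exclude every \<open>c < 0\<close>, and also \<open>c = 0\<close> unless \<open>G\<close> has no edge (in
  which case its density is always 1).
\<close>

definition domination_exponents ::
    "'a pair_pre_digraph \<Rightarrow> 'b pair_pre_digraph \<Rightarrow> real set" where
  "domination_exponents G H =
     {c. \<forall>T :: nat pair_pre_digraph. pair_graph T \<longrightarrow> pverts T \<noteq> {} \<longrightarrow>
           hom_density G T \<ge> hom_density H T powr c}"

text \<open>
  The domination exponent \<open>C(G,H)\<close> is a minimum, hence unique if it exists. It is given as a
  relation because the minimum need not exist: if neither \<open>G\<close> nor \<open>H\<close> has an edge, then all
  densities are 1 and every real number is an admissible exponent.
\<close>

definition is_domination_exponent ::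
    "'a pair_pre_digraph \<Rightarrow> 'b pair_pre_digraph \<Rightarrow> real \<Rightarrow> bool" where
  "is_domination_exponent G H C \<longleftrightarrow>
     C \<in> domination_exponents G H \<and> (\<forall>c \<in> domination_exponents G H. C \<le> c)"

end

theory Submission
  imports Defs "HOL-Analysis.Elementary_Metric_Spaces"
begin

text \<open>
  A homomorphism \<open>\<phi>\<close> from \<open>G\<close> to \<open>H\<close> embeds \<open>G\<close> into the blow-up of \<open>H\<close> restricted to the image
  of \<open>\<phi>\<close>, the vertex \<open>i\<close> being replaced by its fibre, of size \<open>a\<^sub>i\<close>. Blowing up one vertex at a
  time, Jensen's inequality for \<open>x \<mapsto> x ^ a\<^sub>i\<close> gives \<open>t(G,T) \<ge> t(H,T) ^ (\<Prod>i. a\<^sub>i)\<close>. The product is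
  bounded through \<open>a\<^sub>i \<le> m * exp (a\<^sub>i / m - 1)\<close> with \<open>m = e\<close> or \<open>m = v(G) / v(H)\<close>.
  Conversely \<open>T = H\<close> shows that a homomorphism from \<open>G\<close> to \<open>H\<close> is necessary, and also that
  admissible exponents are nonnegative if \<open>H\<close> has an edge; since they form a closed set, their
  infimum is then attained.
\<close>

section \<open>Jensen's inequality and blow-ups\<close>

text \<open>Splits off the value at \<open>j\<close>. The generic monoid form serves both the sums
  over maps and the products over transversals in the blow-up induction.\<close>

lemma (in comm_monoid_set) PiE_insert:
  assumes "j \<notin> K"
  shows "F h (Pi\<^sub>E (insert j K) B) = F (\<lambda>x. F (\<lambda>g. h (g(j := x))) (Pi\<^sub>E K B)) (B j)"
  using inj_combinator[OF assms, of B]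
  by (simp add: PiE_insert_eq reindex cartesian_product comp_def case_prod_unfold)

text \<open>Bernoulli's inequality bounds each \<open>z x ^ a\<close> below by the tangent line of
  the power function at the mean \<open>m\<close>; on averaging, the linear terms cancel.\<close>

lemma mean_power_le:
  fixes z :: "'a \<Rightarrow> real"
  assumes "finite S" and "S \<noteq> {}" and nonneg: "\<And>x. x \<in> S \<Longrightarrow> 0 \<le> z x"
  shows "((\<Sum>x\<in>S. z x) / card S) ^ a \<le> (\<Sum>x\<in>S. z x ^ a) / card S"
proof -
  define m where "m = (\<Sum>x\<in>S. z x) / card S"
  have card: "real (card S) > 0"
    using assms by (simp add: card_gt_0_iff)
  have "m \<ge> 0"
    unfolding m_def by (intro divide_nonneg_nonneg sum_nonneg nonneg) auto
  \<comment> \<open>The tangent argument divides by \<open>m\<close>. For \<open>m = 0\<close> the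
    left side vanishes only if \<open>a > 0\<close>, since \<open>0 ^ 0 = 1\<close>.\<close>
  consider "a = 0" | "a > 0" "m = 0" | "m > 0"
    using \<open>m \<ge> 0\<close> by fastforce
  then have "m ^ a \<le> (\<Sum>x\<in>S. z x ^ a) / card S"
  proof cases
    case 1
    then show ?thesis using card by simp
  next
    case 2
    then show ?thesis by (simp add: zero_power sum_nonneg nonneg)
  next
    case 3
    have "m ^ a * (1 + real a * (z x / m - 1)) \<le> z x ^ a" if "x \<in> S" for x
    proof -
      have "1 + real a * (z x / m - 1) \<le> (1 + (z x / m - 1)) ^ a"
        using 3 nonneg[OF that] by (intro Bernoulli_inequality) simp
      then have "m ^ a * (1 + real a * (z x / m - 1)) \<le> m ^ a * (z x / m) ^ a"
        using 3 by (intro mult_left_mono) auto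
      also have "\<dots> = z x ^ a"
        using 3 by (simp add: power_divide)
      finally show ?thesis .
    qed
    then have "(\<Sum>x\<in>S. m ^ a * (1 + real a * (z x / m - 1))) \<le> (\<Sum>x\<in>S. z x ^ a)"
      by (rule sum_mono)
    also have "(\<Sum>x\<in>S. m ^ a * (1 + real a * (z x / m - 1)))
        = m ^ a * (card S + real a * ((\<Sum>x\<in>S. z x) / m - card S))"
      by (simp add: sum.distrib sum_subtractf flip: sum_distrib_left sum_divide_distrib)
    also have "(\<Sum>x\<in>S. z x) / m = card S"
      using 3 card by (auto simp: m_def field_simps)
    finally show ?thesis
      using card by (simp add: field_simps)
  qed
  then show ?thesis by (simp add: m_def)
qed

text \<open>
  \<open>F\<close> plays the role of the indicator of homomorphisms from a graph on \<open>K\<close> into a graph on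
  \<open>V\<close>; the right-hand side is the density of its blow-up in which the vertex \<open>i\<close> is replaced by
  the independent set \<open>A i\<close>, and \<open>s\<close> ranges over the transversal copies of \<open>K\<close> in the blow-up.
\<close>

lemma blowup_density_ge:
  fixes F :: "('k \<Rightarrow> 'v) \<Rightarrow> real" and A :: "'k \<Rightarrow> 'u set"
  assumes "finite K" and V: "finite V" "V \<noteq> {}"
    and "\<And>i. i \<in> K \<Longrightarrow> finite (A i)" and "\<And>y. 0 \<le> F y"
  shows "((\<Sum>y\<in>K \<rightarrow>\<^sub>E V. F y) / real (card V) ^ card K) ^ (\<Prod>i\<in>K. card (A i))
    \<le> (\<Sum>g\<in>(\<Pi>\<^sub>E i\<in>K. A i \<rightarrow>\<^sub>E V). \<Prod>s\<in>Pi\<^sub>E K A. F (\<lambda>i\<in>K. g i (s i)))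
        / real (card V) ^ (\<Sum>i\<in>K. card (A i))"
  using assms(1,4,5)
proof (induction K arbitrary: F rule: finite_induct)
  case empty
  then show ?case by simp
next
  case (insert j K)
  define W where "W = (\<lambda>i. A i \<rightarrow>\<^sub>E V)"
  define N where "N = real (card V)"
  define M where "M = N ^ (\<Sum>i\<in>K. card (A i))"
  define a where "a = card (A j)"
  define p where "p = (\<Prod>i\<in>K. card (A i))"
  \<comment> \<open>Conditioning on the image \<open>x\<close> of \<open>j\<close>:
    \<open>f x\<close> is the mean of \<open>F\<close> with \<open>j\<close> pinned at
    \<open>x\<close>, and \<open>Q x g\<close> is the product over the transversals of
    \<open>K\<close> for the same pinned function.\<close>
  define Q where "Q x g = (\<Prod>s\<in>Pi\<^sub>E K A. F ((\<lambda>i\<in>K. g i (s i))(j := x)))" for x g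
  define f where "f x = (\<Sum>y\<in>K \<rightarrow>\<^sub>E V. F (y(j := x))) / N ^ card K" for x
  have "N > 0"
    using V by (simp add: N_def card_gt_0_iff)
  have M: "M = card (Pi\<^sub>E K W)"
    using insert.hyps insert.prems
    by (simp add: M_def N_def W_def card_PiE power_sum)
  then have "card (Pi\<^sub>E K W) \<noteq> 0"
    using \<open>N > 0\<close> unfolding M_def by (metis of_nat_0 power_not_zero less_irrefl)
  then have W: "finite (Pi\<^sub>E K W)" "Pi\<^sub>E K W \<noteq> {}" "M > 0"
    using M by (auto simp: card_gt_0_iff intro: card_ge_0_finite)
  have f_nonneg: "0 \<le> f x" for x
    using insert.prems \<open>N > 0\<close> by (simp add: f_def sum_nonneg)
  have Q_nonneg: "0 \<le> Q x g" for x g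
    using insert.prems by (simp add: Q_def prod_nonneg)

  have upd: "(\<lambda>i\<in>insert j K. (g(j := h)) i ((s(j := u)) i)) = (\<lambda>i\<in>K. g i (s i))(j := h u)"
    for g h and s u
    using insert.hyps by (auto simp: fun_eq_iff)
  have "(\<Sum>g\<in>Pi\<^sub>E (insert j K) W. \<Prod>s\<in>Pi\<^sub>E (insert j K) A. F (\<lambda>i\<in>insert j K. g i (s i)))
      = (\<Sum>h\<in>W j. \<Sum>g\<in>Pi\<^sub>E K W. \<Prod>u\<in>A j. Q (h u) g)"
    unfolding Q_def
    by (simp only: sum.PiE_insert[OF insert.hyps(2)] prod.PiE_insert[OF insert.hyps(2)] upd)
  also have "\<dots> = (\<Sum>g\<in>Pi\<^sub>E K W. \<Sum>h\<in>W j. \<Prod>u\<in>A j. Q (h u) g)"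
    by (rule sum.swap)
  \<comment> \<open>Once \<open>g\<close> is fixed, the \<open>a\<close> copies of \<open>j\<close>
    choose their images independently, so the sum over \<open>h\<close> factors into
    \<open>a\<close> equal sums.\<close>
  also have "\<dots> = (\<Sum>g\<in>Pi\<^sub>E K W. (\<Sum>x\<in>V. Q x g) ^ a)"
    using prod_sum_PiE[of "A j" "\<lambda>_. V" "\<lambda>_ x. Q x g" for g, symmetric] insert.prems V
    by (simp add: W_def a_def)
  finally have total: "(\<Sum>g\<in>Pi\<^sub>E (insert j K) W.
      \<Prod>s\<in>Pi\<^sub>E (insert j K) A. F (\<lambda>i\<in>insert j K. g i (s i)))
      = (\<Sum>g\<in>Pi\<^sub>E K W. (\<Sum>x\<in>V. Q x g) ^ a)" .

  have IH: "f x ^ p \<le> (\<Sum>g\<in>Pi\<^sub>E K W. Q x g) / M" for x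
    unfolding f_def p_def Q_def M_def W_def N_def
    by (intro insert.IH[of "\<lambda>y. F (y(j := x))"] insert.prems) auto

  have "((\<Sum>y\<in>insert j K \<rightarrow>\<^sub>E V. F y) / N ^ card (insert j K)) ^ (a * p)
      = (((\<Sum>x\<in>V. f x) / N) ^ p) ^ a"
    using insert.hyps
    by (simp add: sum.PiE_insert f_def sum_divide_distrib mult.commute flip: power_mult)
  \<comment> \<open>Jensen with exponent \<open>p\<close>, averaging over the image of
    \<open>j\<close>; the induction hypothesis then applies to each \<open>f x\<close>.\<close>
  also have "\<dots> \<le> ((\<Sum>x\<in>V. f x ^ p) / N) ^ a"
    unfolding N_def using f_nonneg
    by (intro power_mono mean_power_le V) (auto intro!: zero_le_power divide_nonneg_nonneg sum_nonneg)
  also have "\<dots> \<le> ((\<Sum>x\<in>V. (\<Sum>g\<in>Pi\<^sub>E K W. Q x g) / M) / N) ^ a"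
    using f_nonneg \<open>N > 0\<close>
    by (intro power_mono divide_right_mono sum_mono IH) (auto intro!: divide_nonneg_nonneg sum_nonneg)
  also have "(\<Sum>x\<in>V. (\<Sum>g\<in>Pi\<^sub>E K W. Q x g) / M) = (\<Sum>g\<in>Pi\<^sub>E K W. \<Sum>x\<in>V. Q x g) / M"
    by (subst sum.swap) (simp add: sum_divide_distrib)
  also have "((\<Sum>g\<in>Pi\<^sub>E K W. \<Sum>x\<in>V. Q x g) / M / N) ^ a
      = ((\<Sum>g\<in>Pi\<^sub>E K W. \<Sum>x\<in>V. Q x g) / M) ^ a / N ^ a"
    by (rule power_divide)
  \<comment> \<open>Jensen again, with exponent \<open>a\<close>, averaging over the
    \<open>M\<close> families \<open>g\<close> of maps on the sets \<open>A i\<close> with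
    \<open>i\<close> in \<open>K\<close>.\<close>
  also have "\<dots> \<le> (\<Sum>g\<in>Pi\<^sub>E K W. (\<Sum>x\<in>V. Q x g) ^ a) / M / N ^ a"
    unfolding M using Q_nonneg W \<open>N > 0\<close>
    by (intro divide_right_mono mean_power_le) (auto intro: sum_nonneg)
  also have "\<dots> = (\<Sum>g\<in>Pi\<^sub>E K W. (\<Sum>x\<in>V. Q x g) ^ a) / N ^ (\<Sum>i\<in>insert j K. card (A i))"
    using insert.hyps by (simp add: M_def a_def power_add mult.commute)
  finally show ?case
    unfolding total[symmetric] by (simp only: W_def N_def a_def p_def prod.insert[OF insert.hyps])
qed

section \<open>Products with a prescribed sum\<close>

text \<open>Multiplies the bounds obtained from \<open>1 + t \<le> exp t\<close> at
  \<open>t = x i / m - 1\<close>. The parameter \<open>m\<close> is free; equality holds when every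
  \<open>x i\<close> equals \<open>m\<close>.\<close>

lemma prod_le_power_mult_exp:
  fixes x :: "'a \<Rightarrow> real"
  assumes "finite K" and "m > 0" and nonneg: "\<And>i. i \<in> K \<Longrightarrow> 0 \<le> x i"
  shows "(\<Prod>i\<in>K. x i) \<le> m ^ card K * exp ((\<Sum>i\<in>K. x i) / m - card K)"
proof -
  have "x i \<le> m * exp (x i / m - 1)" for i
  proof -
    have "x i / m \<le> exp (x i / m - 1)"
      using exp_ge_add_one_self[of "x i / m - 1"] by simp
    then show ?thesis using \<open>m > 0\<close> by (simp add: field_simps)
  qed
  then have "(\<Prod>i\<in>K. x i) \<le> (\<Prod>i\<in>K. m * exp (x i / m - 1))"
    by (intro prod_mono) (use nonneg in auto)
  also have "\<dots> = m ^ card K * exp ((\<Sum>i\<in>K. x i) / m - card K)"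
    using assms(1) by (simp add: prod.distrib sum_subtractf sum_divide_distrib flip: exp_sum)
  finally show ?thesis .
qed

text \<open>The previous bound with \<open>m = n / k\<close> in the first case and
  \<open>m = exp 1\<close> in the second. \<open>K\<close> will be the image of a homomorphism and
  \<open>k\<close> the number of vertices of \<open>H\<close>, hence only
  \<open>card K \<le> k\<close>.\<close>

lemma prod_le_domination_bound:
  fixes x :: "'a \<Rightarrow> real"
  assumes "finite K" and nonneg: "\<And>i. i \<in> K \<Longrightarrow> 0 \<le> x i" and n: "(\<Sum>i\<in>K. x i) = n"
    and "card K \<le> k" and "k > 0"
  shows "(\<Prod>i\<in>K. x i) \<le> (if real k \<le> n / exp 1 then (n / k) ^ k else exp (n / exp 1))"
proof (cases "real k \<le> n / exp 1")
  case True
  then have e: "exp 1 \<le> n / k"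
    using \<open>k > 0\<close> by (simp add: field_simps)
  then have pos: "n / k > 0"
    using exp_gt_zero[of "1::real"] by linarith
  have "n \<noteq> 0" using pos by auto
  have "(\<Prod>i\<in>K. x i) \<le> (n / k) ^ card K * exp (n / (n / k) - card K)"
    unfolding n[symmetric]
    by (intro prod_le_power_mult_exp assms nonneg) (use pos n in auto)
  also have "n / (n / k) - card K = real (k - card K) * 1"
    using \<open>n \<noteq> 0\<close> \<open>card K \<le> k\<close> by (simp add: of_nat_diff)
  also have "exp (real (k - card K) * 1) = exp (1::real) ^ (k - card K)"
    by (rule exp_of_nat_mult)
  \<comment> \<open>Each of the \<open>k - card K\<close> surplus factors \<open>exp 1\<close> is at
    most \<open>n / k\<close>, by the case assumption.\<close>
  also have "(n / k) ^ card K * \<dots> \<le> (n / k) ^ card K * (n / k) ^ (k - card K)"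
    using e pos by (intro mult_left_mono power_mono) auto
  also have "\<dots> = (n / k) ^ k"
    using \<open>card K \<le> k\<close> by (simp flip: power_add)
  finally show ?thesis using True by simp
next
  case False
  have "(\<Prod>i\<in>K. x i) \<le> exp 1 ^ card K * exp (n / exp 1 - card K)"
    unfolding n[symmetric] by (intro prod_le_power_mult_exp assms nonneg) auto
  also have "exp (1::real) ^ card K = exp (card K)"
    using exp_of_nat_mult[of "card K" "1::real"] by simp
  also have "exp (real (card K)) * exp (n / exp 1 - card K) = exp (n / exp 1)"
    by (simp flip: exp_add)
  finally show ?thesis using False by simp
qed

section \<open>Homomorphism densities\<close>

lemma finite_graph_homs:
  assumes "finite (pverts H)" and "finite (pverts T)"
  shows "finite (graph_homs H T)"
  by (rule finite_subset[OF _ finite_PiE[of "pverts H" "\<lambda>_. pverts T"]])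
    (use assms in \<open>auto simp: graph_homs_def\<close>)

lemma hom_density_nonneg: "0 \<le> hom_density H T"
  by (simp add: hom_density_def)

lemma hom_count_le:
  assumes "finite (pverts H)" and "finite (pverts T)"
  shows "hom_count H T \<le> card (pverts T) ^ card (pverts H)"
proof -
  have "hom_count H T \<le> card (pverts H \<rightarrow>\<^sub>E pverts T)"
    unfolding hom_count_def
    by (intro card_mono finite_PiE) (use assms in \<open>auto simp: graph_homs_def\<close>)
  then show ?thesis using assms by (simp add: card_PiE)
qed

lemma hom_density_le_1:
  assumes "finite (pverts H)" and "finite (pverts T)"
  shows "hom_density H T \<le> 1"
\<comment> \<open>Exactly here the denominator is 0, and division by zero makes the density
  0.\<close>
proof (cases "pverts T = {} \<and> pverts H \<noteq> {}")
  case True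
  then show ?thesis using assms by (simp add: hom_density_def zero_power card_gt_0_iff)
next
  case False
  then have "real (card (pverts T)) ^ card (pverts H) > 0"
    using assms by (auto simp: card_gt_0_iff)
  then show ?thesis
    unfolding hom_density_def using hom_count_le[OF assms]
    by (simp flip: of_nat_power)
qed

lemma hom_density_pos_iff:
  assumes "finite (pverts H)" and "finite (pverts T)" and "pverts T \<noteq> {}"
  shows "0 < hom_density H T \<longleftrightarrow> graph_homs H T \<noteq> {}"
  using assms finite_graph_homs[OF assms(1,2)]
  by (auto simp: hom_density_def hom_count_def zero_less_divide_iff card_gt_0_iff)

text \<open>A constant map sends an edge of \<open>H\<close> to a loop, which \<open>T\<close> does
  not have, so not every map is a homomorphism.\<close>

lemma hom_density_less_1:
  assumes "pair_graph H" and "parcs H \<noteq> {}" and "pair_graph T" and "pverts T \<noteq> {}"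
  shows "hom_density H T < 1"
proof -
  interpret H: pair_graph H by fact
  interpret T: pair_graph T by fact
  obtain t where t: "t \<in> pverts T" using assms by blast
  obtain u v where uv: "(u, v) \<in> parcs H" using assms by auto
  then have verts: "u \<in> pverts H" "v \<in> pverts H"
    using H.arc_fst_in_verts H.arc_snd_in_verts by fastforce+
  have "(\<lambda>x\<in>pverts H. t) \<notin> graph_homs H T"
    using uv verts T.pair_no_loops[of "(t, t)"] by (force simp: graph_homs_def)
  moreover have "(\<lambda>x\<in>pverts H. t) \<in> pverts H \<rightarrow>\<^sub>E pverts T"
    using t by auto
  moreover have "graph_homs H T \<subseteq> pverts H \<rightarrow>\<^sub>E pverts T"
    by (auto simp: graph_homs_def)
  ultimately have "graph_homs H T \<subset> pverts H \<rightarrow>\<^sub>E pverts T"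
    by blast
  then have "hom_count H T < card (pverts H \<rightarrow>\<^sub>E pverts T)"
    unfolding hom_count_def
    by (intro psubset_card_mono finite_PiE) (auto simp: H.pair_finite_verts T.pair_finite_verts)
  then have "hom_count H T < card (pverts T) ^ card (pverts H)"
    by (simp add: card_PiE H.pair_finite_verts)
  moreover have "card (pverts T) > 0"
    using assms(4) T.pair_finite_verts by (simp add: card_gt_0_iff)
  ultimately show ?thesis
    by (simp add: hom_density_def flip: of_nat_power)
qed

lemma graph_homs_compose:
  assumes "pair_graph G" and "f \<in> graph_homs G H" and "g \<in> graph_homs H T"
  shows "(\<lambda>x\<in>pverts G. g (f x)) \<in> graph_homs G T"
proof -
  interpret G: pair_graph G by fact
  have "u \<in> pverts G" "v \<in> pverts G" if "(u, v) \<in> parcs G" for u v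
    using G.arc_fst_in_verts[OF that] G.arc_snd_in_verts[OF that] by simp_all
  then show ?thesis
    using assms(2,3) by (fastforce simp: graph_homs_def)
qed

text \<open>Admissible targets have natural numbers as vertices, so \<open>H\<close> itself must be
  replaced by a copy when used as a target. Homomorphisms in both directions are all that is needed
  of it.\<close>

lemma ex_nat_copy:
  assumes "pair_graph H"
  obtains T :: "nat pair_pre_digraph" where
    "pair_graph T" "pverts T = {} \<longleftrightarrow> pverts H = {}" "graph_homs H T \<noteq> {}" "graph_homs T H \<noteq> {}"
proof -
  interpret H: pair_graph H by fact
  obtain f :: "'a \<Rightarrow> nat" where f: "inj_on f (pverts H)"
    using finite_imp_inj_to_nat_seg[OF H.pair_finite_verts] by blast
  define T where "T = \<lparr>pverts = f ` pverts H, parcs = map_prod f f ` parcs H\<rparr>"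
  have verts: "u \<in> pverts H" "v \<in> pverts H" if "(u, v) \<in> parcs H" for u v
    using H.arc_fst_in_verts[OF that] H.arc_snd_in_verts[OF that] by simp_all
  have sym: "(v, u) \<in> parcs H" if "(u, v) \<in> parcs H" for u v
    using H.pair_sym_arcs that by (auto simp: symmetric_def dest: symD)
  have ends: "arcs_ends (with_proj T) = parcs T"
    by (simp add: arcs_ends_def arc_to_ends_def)
  have "pair_graph T"
  proof unfold_locales
    show "fst e \<in> pverts T" "snd e \<in> pverts T" if "e \<in> parcs T" for e
      using that verts by (auto simp: T_def)
    show "finite (pverts T)" "finite (parcs T)"
      using H.pair_finite_verts H.pair_finite_arcs by (simp_all add: T_def)
    show "fst e \<noteq> snd e" if "e \<in> parcs T" for e
      using that verts f H.pair_no_loops by (fastforce simp: T_def dest: inj_onD)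
    show "symmetric (with_proj T)"
      unfolding symmetric_def ends using sym by (force simp: T_def intro!: symI)
  qed
  moreover have "(\<lambda>x\<in>pverts H. f x) \<in> graph_homs H T"
    using verts by (force simp: graph_homs_def T_def)
  moreover have "(\<lambda>x\<in>pverts T. the_inv_into (pverts H) f x) \<in> graph_homs T H"
    using verts by (auto simp: graph_homs_def T_def the_inv_into_f_f[OF f]) (metis f inj_onD verts(2))
  ultimately show thesis
    using that[of T] by (auto simp: T_def)
qed

section \<open>From a homomorphism to a density inequality\<close>

text \<open>Restricting \<open>H\<close> to the image of \<open>\<phi>\<close> can only raise its
  density, while every homomorphism from the blow-up by the fibres yields one from \<open>G\<close>.
  The blow-up inequality links the two.\<close>

lemma hom_density_ge_power:
  assumes G: "pair_graph G" and H: "pair_graph H" and T: "pair_graph T" "pverts T \<noteq> {}"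
    and \<phi>: "\<phi> \<in> graph_homs G H"
  shows "hom_density H T ^ (\<Prod>i\<in>\<phi> ` pverts G. card {v \<in> pverts G. \<phi> v = i}) \<le> hom_density G T"
proof -
  interpret G: pair_graph G by fact
  interpret H: pair_graph H by fact
  interpret T: pair_graph T by fact
  note fin = G.pair_finite_verts H.pair_finite_verts T.pair_finite_verts
  define V where "V = pverts T"
  define K where "K = \<phi> ` pverts G"
  define A where "A i = {v \<in> pverts G. \<phi> v = i}" for i
  \<comment> \<open>\<open>P\<close> tests only the edges of \<open>H\<close> inside
    \<open>K\<close>. A member of \<open>W\<close> is a map from the vertices of \<open>G\<close>,
    cut along the fibres of \<open>\<phi>\<close>; it is \<open>good\<close> if it is a homomorphism
    from the blow-up.\<close>
  define P where "P y \<longleftrightarrow> (\<forall>(i, j) \<in> parcs H. i \<in> K \<longrightarrow> j \<in> K \<longrightarrow> (y i, y j) \<in> parcs T)" for y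
  define W where "W = (\<Pi>\<^sub>E i\<in>K. A i \<rightarrow>\<^sub>E V)"
  define good where "good g \<longleftrightarrow> (\<forall>s\<in>Pi\<^sub>E K A. P (\<lambda>i\<in>K. g i (s i)))" for g
  define N where "N = real (card V)"
  have [simp]: "finite V" "finite K" "finite (A i)" for i
    using fin by (auto simp: V_def K_def A_def)
  have "N > 0"
    using T by (simp add: N_def card_gt_0_iff V_def)
  have "K \<subseteq> pverts H"
    using \<phi> by (auto simp: graph_homs_def K_def)
  then have card_K: "card (pverts H) = card K + card (pverts H - K)"
    using fin by (simp add: card_Diff_subset card_mono)
  have verts: "u \<in> pverts G" "v \<in> pverts G" if "(u, v) \<in> parcs G" for u v
    using G.arc_fst_in_verts[OF that] G.arc_snd_in_verts[OF that] by simp_all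
  have card_G: "(\<Sum>i\<in>K. card (A i)) = card (pverts G)"
    using sum.group[OF fin(1), of K \<phi> "\<lambda>_. 1 :: nat"] by (simp add: K_def A_def)

  \<comment> \<open>A homomorphism from \<open>H\<close> is determined by its restriction to
    \<open>K\<close>, which satisfies \<open>P\<close>, and its values off \<open>K\<close>, which
    are bounded by counting all maps there.\<close>
  have "inj_on (\<lambda>y. (restrict y K, restrict y (pverts H - K))) (graph_homs H T)"
  proof (rule inj_onI)
    fix y z assume "y \<in> graph_homs H T" "z \<in> graph_homs H T"
      and "(restrict y K, restrict y (pverts H - K)) = (restrict z K, restrict z (pverts H - K))"
    then have "y x = z x" if "x \<in> pverts H" for x
      using that by (cases "x \<in> K") (auto dest: fun_cong[of _ _ x])
    then show "y = z"
      using \<open>y \<in> _\<close> \<open>z \<in> _\<close> by (auto simp: graph_homs_def intro: PiE_ext)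
  qed
  moreover have "(\<lambda>y. (restrict y K, restrict y (pverts H - K))) ` graph_homs H T
      \<subseteq> {y \<in> K \<rightarrow>\<^sub>E V. P y} \<times> ((pverts H - K) \<rightarrow>\<^sub>E V)"
    using \<open>K \<subseteq> pverts H\<close> by (auto simp: graph_homs_def P_def V_def)
  ultimately have "hom_count H T \<le> card ({y \<in> K \<rightarrow>\<^sub>E V. P y} \<times> ((pverts H - K) \<rightarrow>\<^sub>E V))"
    unfolding hom_count_def
    by (rule card_inj_on_le) (use fin in \<open>auto intro!: finite_cartesian_product finite_Collect_conjI finite_PiE\<close>)
  then have "real (hom_count H T) \<le> card {y \<in> K \<rightarrow>\<^sub>E V. P y} * N ^ card (pverts H - K)"
    using fin by (simp add: card_cartesian_product card_PiE N_def flip: of_nat_power of_nat_mult)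
  then have H_le: "hom_density H T \<le> card {y \<in> K \<rightarrow>\<^sub>E V. P y} / N ^ card K"
    using \<open>N > 0\<close> unfolding hom_density_def card_K V_def[symmetric] N_def[symmetric]
    by (simp add: power_add field_simps)

  have good_hom: "(\<lambda>v\<in>pverts G. g (\<phi> v) v) \<in> graph_homs G T" if "g \<in> W" "good g" for g
  proof -
    have "(g (\<phi> u) u, g (\<phi> v) v) \<in> parcs T" if uv: "(u, v) \<in> parcs G" for u v
    proof -
      have arc: "(\<phi> u, \<phi> v) \<in> parcs H"
        using \<phi> uv by (auto simp: graph_homs_def)
      then have neq: "\<phi> u \<noteq> \<phi> v"
        using H.pair_no_loops by fastforce
      \<comment> \<open>A transversal through both \<open>u\<close> and \<open>v\<close>, possible
        because \<open>\<phi> u \<noteq> \<phi> v\<close>. Its other values are arbitrary; the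
        choice is sound because fibres over \<open>K\<close> are nonempty.\<close>
      define s where "s = (\<lambda>i\<in>K. if i = \<phi> u then u else if i = \<phi> v then v else SOME x. x \<in> A i)"
      have "(SOME x. x \<in> A i) \<in> A i" if "i \<in> K" for i
        using that unfolding some_in_eq by (auto simp: K_def A_def)
      then have "s \<in> Pi\<^sub>E K A"
        using verts[OF uv] by (auto simp: s_def A_def)
      then have "P (\<lambda>i\<in>K. g i (s i))"
        using \<open>good g\<close> by (simp add: good_def)
      moreover have "\<phi> u \<in> K" "\<phi> v \<in> K"
        using verts[OF uv] by (auto simp: K_def)
      ultimately show ?thesis
        using arc neq by (fastforce simp: P_def s_def)
    qed
    moreover have "g (\<phi> v) v \<in> V" if "v \<in> pverts G" for v
      using that \<open>g \<in> W\<close> by (auto simp: W_def K_def A_def PiE_iff)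
    ultimately show ?thesis
      using verts by (auto simp: graph_homs_def V_def)
  qed
  have "inj_on (\<lambda>g. \<lambda>v\<in>pverts G. g (\<phi> v) v) W"
  proof (rule inj_onI)
    fix g h assume gh: "g \<in> W" "h \<in> W"
      and eq: "(\<lambda>v\<in>pverts G. g (\<phi> v) v) = (\<lambda>v\<in>pverts G. h (\<phi> v) v)"
    have "g i v = h i v" if "v \<in> A i" for i v
      using that fun_cong[OF eq, of v] by (auto simp: A_def)
    then have "g i = h i" if "i \<in> K" for i
      using gh that by (intro PiE_ext[of _ "A i" "\<lambda>_. V"]) (auto simp: W_def)
    then show "g = h"
      using gh unfolding W_def by (metis PiE_ext)
  qed
  then have "card {g \<in> W. good g} \<le> hom_count G T"
    unfolding hom_count_def using good_hom
    by (intro card_inj_on_le[of "\<lambda>g. \<lambda>v\<in>pverts G. g (\<phi> v) v"] finite_graph_homs fin)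
      (auto intro: inj_on_subset)
  then have G_ge: "card {g \<in> W. good g} / N ^ card (pverts G) \<le> hom_density G T"
    unfolding hom_density_def V_def[symmetric] N_def[symmetric]
    using \<open>N > 0\<close> by (simp add: divide_right_mono)

  have "hom_density H T ^ (\<Prod>i\<in>K. card (A i))
      \<le> (card {y \<in> K \<rightarrow>\<^sub>E V. P y} / N ^ card K) ^ (\<Prod>i\<in>K. card (A i))"
    by (intro power_mono H_le hom_density_nonneg)
  \<comment> \<open>Counts become sums of indicators, so that the blow-up inequality applies; the
    product of indicators over all transversals is the indicator of \<open>good\<close>.\<close>
  also have "real (card {y \<in> K \<rightarrow>\<^sub>E V. P y}) = (\<Sum>y\<in>K \<rightarrow>\<^sub>E V. of_bool (P y))"
    by (simp add: finite_PiE Int_def)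
  also have "(\<dots> / N ^ card K) ^ (\<Prod>i\<in>K. card (A i))
      \<le> (\<Sum>g\<in>W. \<Prod>s\<in>Pi\<^sub>E K A. of_bool (P (\<lambda>i\<in>K. g i (s i)))) / N ^ (\<Sum>i\<in>K. card (A i))"
    unfolding N_def W_def using T by (intro blowup_density_ge) (auto simp: V_def fin)
  also have "(\<Sum>g\<in>W. \<Prod>s\<in>Pi\<^sub>E K A. of_bool (P (\<lambda>i\<in>K. g i (s i)))) = (\<Sum>g\<in>W. of_bool (good g) :: real)"
  proof (rule sum.cong[OF refl])
    fix g
    show "(\<Prod>s\<in>Pi\<^sub>E K A. of_bool (P (\<lambda>i\<in>K. g i (s i)))) = (of_bool (good g) :: real)"
      by (auto simp: good_def finite_PiE)
  qed
  also have "\<dots> = card {g \<in> W. good g}"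
    by (simp add: finite_PiE Int_def W_def)
  also have "card {g \<in> W. good g} / N ^ (\<Sum>i\<in>K. card (A i)) \<le> hom_density G T"
    using G_ge by (simp add: card_G)
  finally show ?thesis
    by (simp add: K_def A_def)
qed

section \<open>Existence of the minimum\<close>

lemma domination_exponents_min:
  assumes H: "pair_graph H" "pverts H \<noteq> {}" "parcs H \<noteq> {}" and G: "pair_graph G"
    and ex: "domination_exponents G H \<noteq> {}"
  shows "is_domination_exponent G H (Inf (domination_exponents G H))"
proof -
  interpret G: pair_graph G by fact
  interpret H: pair_graph H by fact
  let ?D = "domination_exponents G H"
  \<comment> \<open>In a copy of \<open>H\<close> the density of \<open>H\<close> lies strictly
    between 0 and 1, so a negative power of it would exceed 1.\<close>
  obtain T :: "nat pair_pre_digraph" where T: "pair_graph T" "pverts T \<noteq> {}" "graph_homs H T \<noteq> {}"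
    using ex_nat_copy[OF H(1)] H(2) by metis
  interpret T: pair_graph T by fact
  have "0 < hom_density H T" "hom_density H T < 1"
    using T H hom_density_pos_iff[OF H.pair_finite_verts T.pair_finite_verts] hom_density_less_1
    by auto
  have "0 \<le> c" if "c \<in> ?D" for c
  proof (rule ccontr)
    assume "\<not> 0 \<le> c"
    then have "hom_density H T powr 0 < hom_density H T powr c"
      using \<open>0 < hom_density H T\<close> \<open>hom_density H T < 1\<close> by (intro powr_less_mono') auto
    also have "\<dots> \<le> hom_density G T"
      using that T by (simp add: domination_exponents_def)
    also have "\<dots> \<le> 1"
      by (intro hom_density_le_1 G.pair_finite_verts T.pair_finite_verts)
    finally show False
      using \<open>0 < hom_density H T\<close> by simp
  qed
  then have bdd: "bdd_below ?D"
    by (rule bdd_belowI)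
  have "closed ?D"
  proof -
    have "?D = (\<Inter>T \<in> {T :: nat pair_pre_digraph. pair_graph T \<and> pverts T \<noteq> {}}.
        {c. hom_density H T powr c \<le> hom_density G T})"
      by (auto simp: domination_exponents_def)
    moreover have "closed {c. hom_density H T powr c \<le> hom_density G T}"
      for T :: "nat pair_pre_digraph"
    \<comment> \<open>At density 0 the power is 0 for every \<open>c\<close>, so all
      \<open>c\<close> qualify; otherwise the power is continuous in \<open>c\<close>.\<close>
    proof (cases "hom_density H T = 0")
      case True
      then show ?thesis by (simp add: hom_density_nonneg)
    next
      case False
      then show ?thesis by (intro closed_Collect_le continuous_intros) auto
    qed
    ultimately show ?thesis by (simp add: closed_INT)
  qed
  then have "Inf ?D \<in> ?D"
    using closed_contains_Inf ex bdd by blast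
  then show ?thesis
    using bdd by (auto simp: is_domination_exponent_def intro: cInf_lower)
qed

section \<open>Existence criterion and upper bound\<close>

theorem theorem2p3:
  fixes G :: "'a pair_pre_digraph" and H :: "'b pair_pre_digraph"
  assumes "pair_graph G" and "pair_graph H" and "pverts H \<noteq> {}"
  shows "((\<exists>c. c \<in> domination_exponents G H) \<longleftrightarrow> hom_density G H > 0) \<and>
    (hom_density G H > 0 \<longrightarrow>
      (parcs H \<noteq> {} \<longrightarrow> (\<exists>C. is_domination_exponent G H C)) \<and>
      (\<forall>C. is_domination_exponent G H C \<longrightarrow>
        C \<le> (if real (card (pverts H)) \<le> real (card (pverts G)) / exp 1
             then (real (card (pverts G)) / real (card (pverts H))) ^ card (pverts H)
             else exp (real (card (pverts G)) / exp 1))))"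
proof -
  interpret G: pair_graph G by fact
  interpret H: pair_graph H by fact
  note fin = G.pair_finite_verts H.pair_finite_verts
  let ?B = "if real (card (pverts H)) \<le> real (card (pverts G)) / exp 1
             then (real (card (pverts G)) / real (card (pverts H))) ^ card (pverts H)
             else exp (real (card (pverts G)) / exp 1)"
  have necessary: "hom_density G H > 0" if "c \<in> domination_exponents G H" for c
  proof -
    obtain T :: "nat pair_pre_digraph" where T: "pair_graph T" "pverts T \<noteq> {}"
      and HT: "graph_homs H T \<noteq> {}" and TH: "graph_homs T H \<noteq> {}"
      using ex_nat_copy[OF assms(2)] assms(3) by metis
    interpret T: pair_graph T by fact
    have "hom_density H T > 0"
      using hom_density_pos_iff fin T.pair_finite_verts T HT by blast
    then have "0 < hom_density H T powr c"
      by simp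
    also have "\<dots> \<le> hom_density G T"
      using that T by (simp add: domination_exponents_def)
    \<comment> \<open>A homomorphism from \<open>G\<close> to the copy \<open>T\<close>, followed by
      one from \<open>T\<close> to \<open>H\<close>, gives the required one.\<close>
    finally have "graph_homs G T \<noteq> {}"
      using hom_density_pos_iff fin T.pair_finite_verts T by blast
    then have "graph_homs G H \<noteq> {}"
      using TH graph_homs_compose[OF assms(1)] by blast
    then show ?thesis
      using hom_density_pos_iff fin assms(3) by blast
  qed
  have sufficient: "\<exists>c \<in> domination_exponents G H. c \<le> ?B" if "hom_density G H > 0"
  proof -
    obtain \<phi> where \<phi>: "\<phi> \<in> graph_homs G H"
      using \<open>hom_density G H > 0\<close> hom_density_pos_iff fin assms(3) by blast
    \<comment> \<open>The fibre sizes sum to the number of vertices of \<open>G\<close>, which makes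
      the product bound applicable to this exponent.\<close>
    define c where "c = (\<Prod>i\<in>\<phi> ` pverts G. card {v \<in> pverts G. \<phi> v = i})"
    have "real c \<in> domination_exponents G H"
      unfolding domination_exponents_def
    proof (intro CollectI allI impI)
      fix T :: "nat pair_pre_digraph"
      assume T: "pair_graph T" "pverts T \<noteq> {}"
      show "hom_density H T powr real c \<le> hom_density G T"
      proof (cases "hom_density H T = 0")
        case True
        then show ?thesis by (simp add: hom_density_nonneg)
      next
        case False
        then have "hom_density H T > 0"
          using hom_density_nonneg[of H T] by simp
        then show ?thesis
          using hom_density_ge_power[OF assms(1,2) T \<phi>] by (simp add: powr_realpow flip: c_def)
      qed
    qed
    moreover have "real c \<le> ?B"
      unfolding c_def of_nat_prod
    proof (rule prod_le_domination_bound)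
      show "(\<Sum>i\<in>\<phi> ` pverts G. real (card {v \<in> pverts G. \<phi> v = i})) = real (card (pverts G))"
        using sum.group[OF fin(1), of "\<phi> ` pverts G" \<phi> "\<lambda>_. 1 :: real"] fin by simp
      show "card (\<phi> ` pverts G) \<le> card (pverts H)"
        using \<phi> fin by (intro card_mono) (auto simp: graph_homs_def)
      show "card (pverts H) > 0"
        using fin assms(3) by (simp add: card_gt_0_iff)
    qed (use fin in auto)
    ultimately show ?thesis by blast
  qed
  show ?thesis
  proof (intro conjI impI allI)
    show "(\<exists>c. c \<in> domination_exponents G H) \<longleftrightarrow> hom_density G H > 0"
      using necessary sufficient by blast
    show "\<exists>C. is_domination_exponent G H C" if "hom_density G H > 0" "parcs H \<noteq> {}"
      using domination_exponents_min[OF assms(2,3) that(2) assms(1)] sufficient[OF that(1)] by blast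
    show "C \<le> ?B" if "hom_density G H > 0" "is_domination_exponent G H C" for C
      using sufficient[OF that(1)] that(2) unfolding is_domination_exponent_def
      by (meson order_trans)
  qed
qed

end
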